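(* Let $\mathcal A$ be a restricted matrix interpretation (RMI) for a TRS $\mathcal R$. Let $M$ be the component-wise maximum of all matrices used in the interpretations of constructor symbols of $\mathcal R$, and let $d$ be the number of ones on the diagonal of $M$. Then $\mathcal A$ is of basic degree $d$. Furthermore, if $M$ is the unit matrix then $\mathcal A$ is of basic degree $1$.
   Context: Let $\mathcal R$ be a TRS over signature $\mathcal F$; its defined symbols are the roots of left-hand sides of its rules, the other symbols are constructors. A term $f(t_1,\dots,t_n)$ is basic if $f$ is defined and all $t_i$ are built from constructors and variables. $|t|$ is the number of symbol and variable occurrences in $t$. A matrix interpretation $\mathcal A$ of dimension $k$ assigns to each $n$-ary $f\in\mathcal F$ a map $f_{\mathcal A}(\vec v_1,\dots,\vec v_n)=F_1\vec v_1+\cdots+F_n\vec v_n+\vec f$ with $F_i\in\mathbb N^{k\times k}$, $\vec f\in\mathbb N^k$; $[t]$ denotes the evaluation of $t$ under the assignment mapping all variables to $\vec 0$, and $[t]_j$ its $j$-th component. An upper triangular complexity matrix is $M\in\mathbb N^{k\times k}$ with $M_{j,l}=0$ for $l<j$ and $M_{j,j}\le1$. $\mathcal A$ is an RMI if for every constructor symbol $f$ all matrices $F_1,\dots,F_n$ of $f_{\mathcal A}$ are upper triangular complexity matrices. $\mathcal A$ is of basic degree $d$ if there is a constant $c$ with $[t]_j\le c\cdot|t|^d$ for all basic terms $t$ and all $1\le j\le k$.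
   Formalization: The signature is assumed to be finite; with infinitely many constants of unbounded interpretation the claim fails, and with unboundedly large matrices the component-wise maximum does not exist. *)

theory Defs
  imports "Jordan_Normal_Form.Matrix"
begin

datatype ('f, 'v) fo_term = Var 'v | Fun 'f "('f, 'v) fo_term list"

fun vars :: "('f, 'v) fo_term \<Rightarrow> 'v set" where
  "vars (Var x) = {x}"
| "vars (Fun f ts) = (\<Union>t\<in>set ts. vars t)"

fun term_size :: "('f, 'v) fo_term \<Rightarrow> nat" where
  "term_size (Var x) = 1"
| "term_size (Fun f ts) = 1 + sum_list (map term_size ts)"

text \<open>A signature is a set \<open>F\<close> of symbols together with an arity function \<open>ar\<close>;
  \<open>over G ar t\<close> says that \<open>t\<close> respects the arities and is built from variables and
  symbols in \<open>G\<close>.\<close>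

fun over :: "'f set \<Rightarrow> ('f \<Rightarrow> nat) \<Rightarrow> ('f, 'v) fo_term \<Rightarrow> bool" where
  "over G ar (Var x) \<longleftrightarrow> True"
| "over G ar (Fun f ts) \<longleftrightarrow> f \<in> G \<and> length ts = ar f \<and> (\<forall>t\<in>set ts. over G ar t)"

type_synonym ('f, 'v) rules = "(('f, 'v) fo_term \<times> ('f, 'v) fo_term) set"

text \<open>Signatures are finite, as usual. The set of rules may be infinite.\<close>

definition trs :: "'f set \<Rightarrow> ('f \<Rightarrow> nat) \<Rightarrow> ('f, 'v) rules \<Rightarrow> bool" where
  "trs F ar R \<longleftrightarrow> finite F \<and>
     (\<forall>(l, r)\<in>R. over F ar l \<and> over F ar r \<and> (\<nexists>x. l = Var x) \<and> vars r \<subseteq> vars l)"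

definition defined_symbols :: "('f, 'v) rules \<Rightarrow> 'f set" where
  "defined_symbols R = {f. \<exists>ts r. (Fun f ts, r) \<in> R}"

definition constructors :: "'f set \<Rightarrow> ('f, 'v) rules \<Rightarrow> 'f set" where
  "constructors F R = F - defined_symbols R"

definition basic_terms ::
    "'f set \<Rightarrow> ('f \<Rightarrow> nat) \<Rightarrow> ('f, 'v) rules \<Rightarrow> ('f, 'v) fo_term set" where
  "basic_terms F ar R =
     {Fun f ts | f ts. f \<in> defined_symbols R \<and> length ts = ar f \<and>
        (\<forall>t\<in>set ts. over (constructors F R) ar t)}"

text \<open>\<open>mats A f\<close> is the list \<open>F\<^sub>1, \<dots>, F\<^sub>n\<close> of coefficient matrices of \<open>f\<close>, and
  \<open>absolute A f\<close> is the absolute vector of \<open>f\<close>.\<close>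

record 'f interpretation_data =
  mats :: "'f \<Rightarrow> nat mat list"
  absolute :: "'f \<Rightarrow> nat vec"

definition matrix_interpretation ::
    "nat \<Rightarrow> 'f set \<Rightarrow> ('f \<Rightarrow> nat) \<Rightarrow> 'f interpretation_data \<Rightarrow> bool" where
  "matrix_interpretation k F ar A \<longleftrightarrow>
     (\<forall>f\<in>F. length (mats A f) = ar f \<and> set (mats A f) \<subseteq> carrier_mat k k \<and>
        absolute A f \<in> carrier_vec k)"

definition interp :: "'f interpretation_data \<Rightarrow> 'f \<Rightarrow> nat vec list \<Rightarrow> nat vec" where
  "interp A f vs = foldr (+) (map2 (*\<^sub>v) (mats A f) vs) (absolute A f)"

fun eval_term ::
    "'f interpretation_data \<Rightarrow> ('v \<Rightarrow> nat vec) \<Rightarrow> ('f, 'v) fo_term \<Rightarrow> nat vec" where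
  "eval_term A \<alpha> (Var x) = \<alpha> x"
| "eval_term A \<alpha> (Fun f ts) = interp A f (map (eval_term A \<alpha>) ts)"

definition eval_zero ::
    "nat \<Rightarrow> 'f interpretation_data \<Rightarrow> ('f, 'v) fo_term \<Rightarrow> nat vec" where
  "eval_zero k A t = eval_term A (\<lambda>x. 0\<^sub>v k) t"

definition complexity_matrix :: "nat \<Rightarrow> nat mat \<Rightarrow> bool" where
  "complexity_matrix k M \<longleftrightarrow>
     M \<in> carrier_mat k k \<and> upper_triangular M \<and> (\<forall>j<k. M $$ (j, j) \<le> 1)"

definition RMI ::
    "nat \<Rightarrow> 'f set \<Rightarrow> ('f \<Rightarrow> nat) \<Rightarrow> ('f, 'v) rules \<Rightarrow> 'f interpretation_data \<Rightarrow> bool" where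
  "RMI k F ar R A \<longleftrightarrow> matrix_interpretation k F ar A \<and>
     (\<forall>f\<in>constructors F R. \<forall>G\<in>set (mats A f). complexity_matrix k G)"

definition basic_degree ::
    "nat \<Rightarrow> 'f set \<Rightarrow> ('f \<Rightarrow> nat) \<Rightarrow> ('f, 'v) rules \<Rightarrow> 'f interpretation_data \<Rightarrow> nat \<Rightarrow> bool" where
  "basic_degree k F ar R A d \<longleftrightarrow>
     (\<exists>c::nat. \<forall>t\<in>basic_terms F ar R. \<forall>j<k. eval_zero k A t $ j \<le> c * term_size t ^ d)"

definition constructor_matrices ::
    "'f set \<Rightarrow> ('f, 'v) rules \<Rightarrow> 'f interpretation_data \<Rightarrow> nat mat set" where
  "constructor_matrices F R A = (\<Union>f\<in>constructors F R. set (mats A f))"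

text \<open>Component-wise maximum of a finite set of matrices. Inserting \<open>0\<close> only matters for
  the empty set (no constructor of positive arity), whose maximum is the zero matrix.\<close>

definition max_mat :: "nat \<Rightarrow> nat mat set \<Rightarrow> nat mat" where
  "max_mat k S = mat k k (\<lambda>(i, j). Max (insert 0 {G $$ (i, j) | G. G \<in> S}))"

definition diagonal_ones :: "nat \<Rightarrow> nat mat \<Rightarrow> nat" where
  "diagonal_ones k M = card {i. i < k \<and> M $$ (i, i) = 1}"

end

theory Submission imports Defs begin

text \<open>By upper triangularity, component \<open>i\<close> of the value of a constructor term \<open>f(t\<^sub>1, \<dots>, t\<^sub>n)\<close> is
  bounded by \<open>M\<^sub>i\<^sub>i\<close> times the sum of the components \<open>i\<close> of the values of the \<open>t\<^sub>s\<close>, plus a term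
  that only involves components \<open>j > i\<close>. Descending through the components, the degree
  therefore grows by one exactly at those \<open>i\<close> with \<open>M\<^sub>i\<^sub>i = 1\<close>, because a sum over all subterms of
  contributions of degree \<open>e\<close> has degree \<open>e + 1\<close>. The defined symbol at the root of a basic term
  is applied only once and costs a constant factor. If \<open>M\<close> is the unit matrix, then the components do
  not interact and the sum of the bounded absolute values is linear.\<close>

section \<open>Term sizes and additive recurrences over terms\<close>

lemma term_size_pos: "1 \<le> term_size t"
  by (cases t) auto

lemma term_size_arg_le: "t \<in> set ts \<Longrightarrow> term_size t \<le> term_size (Fun f ts)"
  using member_le_sum_list[of "term_size t" "map term_size ts"] by simp

lemma over_mono: "over G ar t \<Longrightarrow> G \<subseteq> H \<Longrightarrow> over H ar t"
  by (induction t) auto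

lemma sum_list_le_length_mult:
  "(\<And>x. x \<in> set xs \<Longrightarrow> f x \<le> (c::nat)) \<Longrightarrow> sum_list (map f xs) \<le> length xs * c"
  using sum_list_mono[of xs f "\<lambda>_. c"] by (simp add: sum_list_triv)

lemma finite_bounded_nat:
  "finite S \<Longrightarrow> \<exists>c::nat. \<forall>x\<in>S. g x \<le> c"
  using finite_nat_set_iff_bounded_le[of "g ` S"] by auto

text \<open>Unfolded, the recurrence adds a contribution of order \<open>e\<close> for every
  subterm. At most \<open>term_size t\<close> subterms contribute, which costs one extra
  degree.\<close>

lemma additive_recurrence_bound:
  fixes g :: "('f, 'v) fo_term \<Rightarrow> nat"
  assumes var: "\<And>x. g (Var x) = 0"
    and func: "\<And>f ts. over C ar (Fun f ts) \<Longrightarrow>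
        g (Fun f ts) \<le> D * term_size (Fun f ts) ^ e + sum_list (map g ts)"
    and "over C ar t"
  shows "g t \<le> D * term_size t ^ (e + 1)"
  using \<open>over C ar t\<close>
proof (induction t)
  case (Fun f ts)
  let ?n = "term_size (Fun f ts)"
  \<comment> \<open>Only \<open>e\<close> of the \<open>e + 1\<close> factors are enlarged to
    \<open>?n\<close>. The linear factor that is kept lets the argument sizes add up to
    \<open>?n - 1\<close>, and the missing 1 pays for the contribution of the root.\<close>
  have "g s \<le> D * ?n ^ e * term_size s" if "s \<in> set ts" for s
  proof -
    have "g s \<le> D * term_size s ^ (e + 1)"
      using Fun that by simp
    also have "\<dots> = D * term_size s ^ e * term_size s"
      by simp
    also have "\<dots> \<le> D * ?n ^ e * term_size s"
      by (intro mult_mono power_mono term_size_arg_le that) auto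
    finally show ?thesis .
  qed
  then have "sum_list (map g ts) \<le> (\<Sum>s\<leftarrow>ts. D * ?n ^ e * term_size s)"
    by (rule sum_list_mono)
  also have "\<dots> = D * ?n ^ e * sum_list (map term_size ts)"
    by (rule sum_list_const_mult)
  finally have "g (Fun f ts) \<le> D * ?n ^ e * (1 + sum_list (map term_size ts))"
    using func[OF Fun.prems] unfolding distrib_left mult_1_right by linarith
  then show ?case
    by (simp add: mult_ac)
qed (simp add: var)

section \<open>Evaluation of terms and uniform bounds on the interpretation\<close>

lemma foldr_add_vec:
  assumes "a \<in> carrier_vec k" "set us \<subseteq> carrier_vec k"
  shows "foldr (+) us a \<in> carrier_vec k \<and>
    (\<forall>i<k. foldr (+) us a $ i = (a $ i :: nat) + (\<Sum>u\<leftarrow>us. u $ i))"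
  using assms(2) by (induction us) (use assms(1) in auto)

lemma map2_mult_mat_vec_carrier:
  "set Gs \<subseteq> carrier_mat k k \<Longrightarrow> set (map2 (*\<^sub>v) Gs vs) \<subseteq> carrier_vec k"
  by (fastforce dest: set_zip_leftD simp: mult_mat_vec_def)

lemma sum_list_map2_mult_mat_vec_le:
  fixes Gs :: "nat mat list"
  assumes "length Gs = length vs" "set Gs \<subseteq> carrier_mat k k" "set vs \<subseteq> carrier_vec k" "i < k"
    and "\<And>G j. G \<in> set Gs \<Longrightarrow> j < k \<Longrightarrow> G $$ (i, j) \<le> B j"
  shows "(\<Sum>u\<leftarrow>map2 (*\<^sub>v) Gs vs. u $ i) \<le> (\<Sum>v\<leftarrow>vs. \<Sum>j<k. B j * v $ j)"
  using assms
proof (induction Gs vs rule: list_induct2)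
  case (Cons G Gs v vs)
  then have "(G *\<^sub>v v) $ i = (\<Sum>j<k. G $$ (i, j) * v $ j)"
    by (auto simp: scalar_prod_def lessThan_atLeast0 intro!: sum.cong)
  also have "\<dots> \<le> (\<Sum>j<k. B j * v $ j)"
    using Cons.prems by (intro sum_mono mult_right_mono) auto
  finally show ?case
    using Cons by (simp add: add_mono)
qed simp

text \<open>The dimension of a matrix-vector product is the number of rows of the matrix, whatever
  the vector. Hence a case distinction on the root suffices, without induction.\<close>

lemma eval_zero_carrier:
  assumes "matrix_interpretation k F ar A" "over F ar t"
  shows "eval_zero k A t \<in> carrier_vec k"
proof (cases t)
  case (Fun f ts)
  then show ?thesis
    using assms foldr_add_vec[OF _ map2_mult_mat_vec_carrier]
    by (auto simp: eval_zero_def interp_def matrix_interpretation_def)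
qed (simp add: eval_zero_def)

text \<open>A single row \<open>B\<close> dominates row \<open>i\<close> of all coefficient matrices
  of \<open>f\<close>. It is chosen later as a triangular row, a unit row, or a constant
  row.\<close>

lemma eval_zero_Fun_le:
  fixes ts :: "('f, 'v) fo_term list"
  assumes mi: "matrix_interpretation k F ar A" and ov: "over F ar (Fun f ts)" and i: "i < k"
    and B: "\<And>G j. G \<in> set (mats A f) \<Longrightarrow> j < k \<Longrightarrow> G $$ (i, j) \<le> B j"
  shows "eval_zero k A (Fun f ts) $ i
    \<le> absolute A f $ i + (\<Sum>s\<leftarrow>ts. \<Sum>j<k. B j * eval_zero k A s $ j)"
proof -
  let ?vs = "map (eval_zero k A) ts"
  have len: "length (mats A f) = length ?vs" and Gs: "set (mats A f) \<subseteq> carrier_mat k k"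
    and a: "absolute A f \<in> carrier_vec k"
    using mi ov by (auto simp: matrix_interpretation_def)
  have vs: "set ?vs \<subseteq> carrier_vec k"
    using eval_zero_carrier[OF mi] ov by auto
  have "eval_zero k A (Fun f ts) = interp A f ?vs"
    by (simp add: eval_zero_def cong: map_cong)
  then have "eval_zero k A (Fun f ts) $ i
      = absolute A f $ i + (\<Sum>u\<leftarrow>map2 (*\<^sub>v) (mats A f) ?vs. u $ i)"
    using foldr_add_vec[OF a map2_mult_mat_vec_carrier[OF Gs]] i by (simp add: interp_def)
  also have "\<dots> \<le> absolute A f $ i + (\<Sum>v\<leftarrow>?vs. \<Sum>j<k. B j * v $ j)"
    using sum_list_map2_mult_mat_vec_le[OF len Gs vs i B] by simp
  finally show ?thesis
    by (simp add: comp_def)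
qed

text \<open>Finiteness of the signature leaves finitely many arities and entries, so one constant
  can serve for all symbols at once.\<close>

lemma interpretation_bounds:
  assumes "finite F"
  obtains N where
    "\<And>f. f \<in> F \<Longrightarrow> ar f \<le> N"
    "\<And>f i. f \<in> F \<Longrightarrow> i < k \<Longrightarrow> absolute A f $ i \<le> N"
    "\<And>f G i j. f \<in> F \<Longrightarrow> G \<in> set (mats A f) \<Longrightarrow> i < k \<Longrightarrow> j < k \<Longrightarrow> (G $$ (i, j) :: nat) \<le> N"
proof -
  have "finite (F \<times> {..<k})" "finite ((\<Union>f\<in>F. set (mats A f)) \<times> {..<k} \<times> {..<k})"
    using assms by auto
  then obtain a b c where
    a: "\<forall>f\<in>F. ar f \<le> a" and
    b: "\<forall>p\<in>F \<times> {..<k}. absolute A (fst p) $ snd p \<le> b" and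
    c: "\<forall>p\<in>(\<Union>f\<in>F. set (mats A f)) \<times> {..<k} \<times> {..<k}. fst p $$ snd p \<le> c"
    using finite_bounded_nat[OF assms, of ar]
      finite_bounded_nat[of "F \<times> {..<k}" "\<lambda>p. absolute A (fst p) $ snd p"]
      finite_bounded_nat[of "(\<Union>f\<in>F. set (mats A f)) \<times> {..<k} \<times> {..<k}" "\<lambda>p. fst p $$ snd p"]
    by blast
  show thesis
  proof (rule that[of "a + b + c"])
    show "ar f \<le> a + b + c" if "f \<in> F" for f
      using a that by (simp add: add.assoc trans_le_add1)
    show "absolute A f $ i \<le> a + b + c" if "f \<in> F" "i < k" for f i
      using bspec[OF b, of "(f, i)"] that by simp
    show "G $$ (i, j) \<le> a + b + c" if "f \<in> F" "G \<in> set (mats A f)" "i < k" "j < k" for f G i j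
      using bspec[OF c, of "(G, i, j)"] that by (fastforce intro: trans_le_add2)
  qed
qed

lemma le_max_mat:
  assumes "finite S" "G \<in> S" "i < k" "j < k"
  shows "G $$ (i, j) \<le> max_mat k S $$ (i, j)"
proof -
  have "{G $$ (i, j) | G. G \<in> S} = (\<lambda>G. G $$ (i, j)) ` S"
    by auto
  with assms show ?thesis
    by (auto simp: max_mat_def intro!: Max_ge)
qed

lemma max_mat_le:
  assumes "finite S" "i < k" "j < k" "\<And>G. G \<in> S \<Longrightarrow> G $$ (i, j) \<le> c"
  shows "max_mat k S $$ (i, j) \<le> c"
proof -
  have "{G $$ (i, j) | G. G \<in> S} = (\<lambda>G. G $$ (i, j)) ` S"
    by auto
  with assms show ?thesis
    by (auto simp: max_mat_def)
qed

text \<open>The arity bound \<open>N\<close> is only needed when \<open>e = 0\<close>; it gives all exponents a uniform treatment.\<close>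

lemma sum_list_args_le:
  assumes "\<And>s. s \<in> set ts \<Longrightarrow> h s \<le> (c::nat) * term_size s ^ e" "length ts \<le> N"
  shows "sum_list (map h ts) \<le> N * c * term_size (Fun f ts) ^ e"
proof -
  have "h s \<le> c * term_size (Fun f ts) ^ e" if "s \<in> set ts" for s
    using assms(1)[OF that] mult_left_mono[OF power_mono[OF term_size_arg_le[OF that]], of c e f]
    by (meson le_trans zero_le)
  then have "sum_list (map h ts) \<le> length ts * (c * term_size (Fun f ts) ^ e)"
    by (rule sum_list_le_length_mult)
  also have "\<dots> \<le> N * (c * term_size (Fun f ts) ^ e)"
    using assms(2) by (rule mult_right_mono) simp
  finally show ?thesis
    by (simp add: mult_ac)
qed

section \<open>Growth on constructor terms and on basic terms\<close>

lemma le_mult_term_size_power: "a \<le> (a::nat) * term_size t ^ e"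
  using term_size_pos[of t] by simp

text \<open>Downward induction on \<open>i\<close>, starting from the vacuous case
  \<open>i = k\<close>. All components from \<open>i\<close> on share one exponent, so that the
  induction hypothesis covers every column to the right of the diagonal.\<close>

lemma constructor_term_component_bound:
  fixes R :: "('f, 'v) rules"
  assumes fin: "finite F" and rmi: "RMI k F ar R A"
    and M: "M = max_mat k (constructor_matrices F R A)"
    and "i \<le> k"
  shows "\<exists>c. \<forall>t :: ('f, 'v) fo_term. over (constructors F R) ar t \<longrightarrow> (\<forall>j. i \<le> j \<and> j < k \<longrightarrow>
    eval_zero k A t $ j \<le> c * term_size t ^ card {l. i \<le> l \<and> l < k \<and> M $$ (l, l) = 1})"
  using \<open>i \<le> k\<close>
proof (induction i rule: inc_induct)
  case base
  then show ?case by auto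
next
  case (step n)
  let ?C = "constructors F R"
  let ?ev = "eval_zero k A :: ('f, 'v) fo_term \<Rightarrow> nat vec"
  define E where "E = (\<lambda>i. {l. i \<le> l \<and> l < k \<and> M $$ (l, l) = 1})"
  define e where "e = card (E (Suc n))"
  obtain c where c: "?ev t $ j \<le> c * term_size t ^ e"
    if "over ?C ar t" "Suc n \<le> j" "j < k" for t j
    using step.IH unfolding e_def E_def by blast
  obtain N where N: "\<And>f. f \<in> F \<Longrightarrow> ar f \<le> N" "\<And>f i. f \<in> F \<Longrightarrow> i < k \<Longrightarrow> absolute A f $ i \<le> N"
    "\<And>f G i j. f \<in> F \<Longrightarrow> G \<in> set (mats A f) \<Longrightarrow> i < k \<Longrightarrow> j < k \<Longrightarrow> G $$ (i, j) \<le> N"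
    using interpretation_bounds[OF fin] by metis
  have n: "n < k" using step.hyps by simp
  have sub: "?C \<subseteq> F" by (auto simp: constructors_def)
  have mi: "matrix_interpretation k F ar A" using rmi by (simp add: RMI_def)
  have cm: "complexity_matrix k G" if "f \<in> ?C" "G \<in> set (mats A f)" for f G
    using rmi that by (auto simp: RMI_def)
  have finS: "finite (constructor_matrices F R A)"
    using fin by (auto simp: constructor_matrices_def constructors_def)
  have Mle: "M $$ (n, n) \<le> 1"
    unfolding M by (rule max_mat_le[OF finS n n])
      (use cm n in \<open>auto simp: constructor_matrices_def complexity_matrix_def\<close>)
  \<comment> \<open>Row \<open>n\<close> is zero left of the diagonal by triangularity. The exact
    maximum is kept on the diagonal, since it decides the degree; the coarse bound \<open>N\<close>
    suffices to the right.\<close>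
  define B where "B = (\<lambda>j. if j = n then M $$ (n, n) else if n < j then N else 0)"
  have B: "G $$ (n, j) \<le> B j" if "f \<in> ?C" "G \<in> set (mats A f)" "j < k" for f G j
    using that cm[OF that(1,2)] le_max_mat[OF finS, of G n k n] N(3)[of f G n j] n sub
    by (auto simp: B_def M constructor_matrices_def complexity_matrix_def upper_triangular_def)
  \<comment> \<open>The first \<open>N\<close> bounds the absolute vector. The product counts at
    most \<open>N\<close> arguments with at most \<open>k\<close> columns each, every column
    contributing a coefficient \<open>N\<close> and the constant \<open>c\<close> of the induction
    hypothesis.\<close>
  define D where "D = N + N * (k * N * c)"
  have rec: "?ev (Fun f ts) $ n \<le> D * term_size (Fun f ts) ^ e
      + sum_list (map (\<lambda>s. M $$ (n, n) * ?ev s $ n) ts)"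
    if ov: "over ?C ar (Fun f ts)" for f ts
  proof -
    define h where "h s = (\<Sum>j\<in>{..<k} - {n}. B j * ?ev s $ j)" for s
    have fF: "f \<in> F" and fC: "f \<in> ?C" using ov sub by auto
    have "h s \<le> k * N * c * term_size s ^ e" if s: "s \<in> set ts" for s
    proof -
      \<comment> \<open>For \<open>j < n\<close> the coefficient vanishes; for \<open>j > n\<close>
        the induction hypothesis applies.\<close>
      have "B j * ?ev s $ j \<le> N * (c * term_size s ^ e)" if "j \<in> {..<k} - {n}" for j
        using c[of s j] ov s that by (auto simp: B_def intro: mult_left_mono)
      then have "h s \<le> card ({..<k} - {n}) * (N * (c * term_size s ^ e))"
        unfolding h_def by (rule sum_bounded_above[of _ _ "N * (c * term_size s ^ e)", simplified])
      also have "\<dots> \<le> k * (N * (c * term_size s ^ e))"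
        by (intro mult_right_mono) (use card_mono[of "{..<k}" "{..<k} - {n}"] in auto)
      finally show ?thesis by (simp add: mult_ac)
    qed
    then have h: "sum_list (map h ts) \<le> N * (k * N * c) * term_size (Fun f ts) ^ e"
      using ov N(1)[OF fF] by (intro sum_list_args_le) auto
    have "(\<Sum>j<k. B j * ?ev s $ j) = M $$ (n, n) * ?ev s $ n + h s" for s
      using sum.remove[of "{..<k}" n "\<lambda>j. B j * ?ev s $ j"] n by (simp add: h_def B_def)
    then have "?ev (Fun f ts) $ n
        \<le> absolute A f $ n + (\<Sum>s\<leftarrow>ts. M $$ (n, n) * ?ev s $ n + h s)"
      using eval_zero_Fun_le[OF mi over_mono[OF ov sub] n, of B] B[OF fC] by simp
    also have "\<dots> \<le> N * term_size (Fun f ts) ^ e + ((\<Sum>s\<leftarrow>ts. M $$ (n, n) * ?ev s $ n)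
        + N * (k * N * c) * term_size (Fun f ts) ^ e)"
      unfolding sum_list_addf
      by (intro add_mono order.refl h order.trans[OF N(2)[OF fF n] le_mult_term_size_power])
    finally show ?thesis
      by (simp add: D_def distrib_right)
  qed
  \<comment> \<open>A diagonal entry 1 gives an additive recurrence and raises the exponent by one.
    A diagonal entry 0 removes component \<open>n\<close> from the right-hand side of
    \<open>rec\<close>, so the exponent stays \<open>e\<close>.\<close>
  have main: "?ev t $ n \<le> D * term_size t ^ card (E n)" if ov: "over ?C ar t" for t
  proof (cases "M $$ (n, n) = 1")
    case True
    then have "E n = insert n (E (Suc n))"
      using n by (auto simp: E_def not_less_eq_eq order.antisym)
    then have "card (E n) = e + 1"
      by (simp add: e_def E_def)
    moreover have "?ev t $ n \<le> D * term_size t ^ (e + 1)"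
      by (rule additive_recurrence_bound[OF _ _ ov]) (use rec True n in \<open>auto simp: eval_zero_def\<close>)
    ultimately show ?thesis by simp
  next
    case False
    then have "E n = E (Suc n)"
      by (auto simp: E_def Suc_le_eq le_less)
    then have "card (E n) = e"
      by (simp add: e_def)
    moreover have "M $$ (n, n) = 0"
      using False Mle by simp
    ultimately show ?thesis
      using rec ov n by (cases t) (auto simp: eval_zero_def)
  qed
  \<comment> \<open>The sum \<open>D + c\<close> covers both the new component \<open>n\<close> and
    the old ones, whose exponent may be raised because term sizes are at least 1.\<close>
  have "?ev t $ j \<le> (D + c) * term_size t ^ card (E n)"
    if ov: "over ?C ar t" and j: "n \<le> j" "j < k" for t j
  proof (cases "j = n")
    case True
    then show ?thesis
      using main[OF ov] by (simp add: distrib_right)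
  next
    case False
    have "e \<le> card (E n)"
      unfolding e_def E_def by (rule card_mono) auto
    then have "term_size t ^ e \<le> term_size t ^ card (E n)"
      using term_size_pos by (rule power_increasing)
    then have "c * term_size t ^ e \<le> c * term_size t ^ card (E n)"
      by simp
    moreover have "?ev t $ j \<le> c * term_size t ^ e"
      using c[OF ov _ j(2)] False j by simp
    ultimately show ?thesis
      unfolding distrib_right by linarith
  qed
  then show ?case
    unfolding E_def by blast
qed

text \<open>Every row is dominated by a unit row, so each component satisfies its own additive
  recurrence with bounded contributions, the case \<open>e = 0\<close>.\<close>

lemma unit_constructor_term_bound:
  fixes R :: "('f, 'v) rules"
  assumes fin: "finite F" and mi: "matrix_interpretation k F ar A"
    and M: "max_mat k (constructor_matrices F R A) = 1\<^sub>m k"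
  shows "\<exists>c. \<forall>t :: ('f, 'v) fo_term. over (constructors F R) ar t \<longrightarrow>
    (\<forall>j<k. eval_zero k A t $ j \<le> c * term_size t ^ 1)"
proof -
  let ?C = "constructors F R"
  let ?ev = "eval_zero k A :: ('f, 'v) fo_term \<Rightarrow> nat vec"
  obtain N where N: "\<And>f i. f \<in> F \<Longrightarrow> i < k \<Longrightarrow> absolute A f $ i \<le> N"
    using interpretation_bounds[OF fin] by metis
  have sub: "?C \<subseteq> F" by (auto simp: constructors_def)
  have finS: "finite (constructor_matrices F R A)"
    using fin by (auto simp: constructor_matrices_def constructors_def)
  have "?ev t $ i \<le> N * term_size t ^ (0 + 1)" if "over ?C ar t" and i: "i < k" for t i
  proof (rule additive_recurrence_bound[OF _ _ that(1)])
    fix f and ts :: "('f, 'v) fo_term list"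
    assume ov: "over ?C ar (Fun f ts)"
    have B: "G $$ (i, j) \<le> (if j = i then 1 else 0)" if "G \<in> set (mats A f)" "j < k" for G j
    proof -
      have "G \<in> constructor_matrices F R A"
        using that ov by (auto simp: constructor_matrices_def)
      from le_max_mat[OF finS this i that(2)] show ?thesis
        unfolding M using i that by auto
    qed
    have "(\<Sum>j<k. (if j = i then 1 else 0) * ?ev s $ j) = ?ev s $ i" for s
      using i by (simp add: if_distrib[of "\<lambda>x. x * _"] cong: if_cong)
    then have "?ev (Fun f ts) $ i \<le> absolute A f $ i + (\<Sum>s\<leftarrow>ts. ?ev s $ i)"
      using eval_zero_Fun_le[OF mi over_mono[OF ov sub] i, of "\<lambda>j. if j = i then 1 else 0"] B
      by simp
    then show "?ev (Fun f ts) $ i \<le> N * term_size (Fun f ts) ^ 0 + (\<Sum>s\<leftarrow>ts. ?ev s $ i)"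
      using N[of f i] ov sub i by fastforce
  qed (use i in \<open>auto simp: eval_zero_def\<close>)
  then show ?thesis by auto
qed

text \<open>The matrices of the defined root may be arbitrary, but they act only once, on arguments
  that are constructor terms. Bounding all their entries by \<open>N\<close> changes the constant
  and keeps the degree.\<close>

lemma basic_degreeI:
  fixes R :: "('f, 'v) rules"
  assumes trs: "trs F ar R" and mi: "matrix_interpretation k F ar A"
    and "\<exists>c. \<forall>t :: ('f, 'v) fo_term. over (constructors F R) ar t \<longrightarrow>
      (\<forall>j<k. eval_zero k A t $ j \<le> c * term_size t ^ d)"
  shows "basic_degree k F ar R A d"
proof -
  let ?C = "constructors F R"
  let ?ev = "eval_zero k A :: ('f, 'v) fo_term \<Rightarrow> nat vec"
  obtain c where c: "?ev t $ j \<le> c * term_size t ^ d" if "over ?C ar t" "j < k" for t j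
    using assms(3) by blast
  have fin: "finite F" using trs by (simp add: trs_def)
  obtain N where N: "\<And>f. f \<in> F \<Longrightarrow> ar f \<le> N" "\<And>f i. f \<in> F \<Longrightarrow> i < k \<Longrightarrow> absolute A f $ i \<le> N"
    "\<And>f G i j. f \<in> F \<Longrightarrow> G \<in> set (mats A f) \<Longrightarrow> i < k \<Longrightarrow> j < k \<Longrightarrow> G $$ (i, j) \<le> N"
    using interpretation_bounds[OF fin] by metis
  have "?ev t $ i \<le> (N + N * (k * N * c)) * term_size t ^ d"
    if t: "t \<in> basic_terms F ar R" and i: "i < k" for t i
  proof -
    obtain f ts where t: "t = Fun f ts" and f: "f \<in> defined_symbols R" and len: "length ts = ar f"
      and ts: "\<And>s. s \<in> set ts \<Longrightarrow> over ?C ar s"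
      using t by (auto simp: basic_terms_def)
    have fF: "f \<in> F"
      using f trs by (fastforce simp: defined_symbols_def trs_def)
    then have ov: "over F ar (Fun f ts)"
      using len ts over_mono[of ?C ar _ F] by (auto simp: constructors_def)
    have "(\<Sum>j<k. N * ?ev s $ j) \<le> k * N * c * term_size s ^ d" if s: "s \<in> set ts" for s
    proof -
      have "N * ?ev s $ j \<le> N * (c * term_size s ^ d)" if "j \<in> {..<k}" for j
        using c[OF ts[OF s], of j] that by (auto intro: mult_left_mono)
      from sum_bounded_above[of "{..<k}", OF this] show ?thesis
        by (simp add: mult_ac)
    qed
    then have "(\<Sum>s\<leftarrow>ts. \<Sum>j<k. N * ?ev s $ j) \<le> N * (k * N * c) * term_size (Fun f ts) ^ d"
      using len N(1)[OF fF] by (intro sum_list_args_le) auto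
    moreover have "absolute A f $ i \<le> N * term_size (Fun f ts) ^ d"
      using N(2)[OF fF i] le_mult_term_size_power by (rule order.trans)
    moreover have "?ev (Fun f ts) $ i \<le> absolute A f $ i + (\<Sum>s\<leftarrow>ts. \<Sum>j<k. N * ?ev s $ j)"
      using eval_zero_Fun_le[OF mi ov i, of "\<lambda>_. N"] N(3)[OF fF _ i] by simp
    ultimately show ?thesis
      unfolding t distrib_right by linarith
  qed
  then show ?thesis
    unfolding basic_degree_def by blast
qed

theorem theorem9:
  fixes k :: nat
    and F :: "'f set"
    and ar :: "'f \<Rightarrow> nat"
    and R :: "('f, 'v) rules"
    and A :: "'f interpretation_data"
    and M :: "nat mat"
    and d :: nat
  assumes "trs F ar R"
    and "RMI k F ar R A"
    and "M = max_mat k (constructor_matrices F R A)"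
    and "d = diagonal_ones k M"
  shows "basic_degree k F ar R A d \<and> (M = 1\<^sub>m k \<longrightarrow> basic_degree k F ar R A 1)"
proof -
  have fin: "finite F" using assms(1) by (simp add: trs_def)
  have mi: "matrix_interpretation k F ar A" using assms(2) by (simp add: RMI_def)
  have "basic_degree k F ar R A d"
    \<comment> \<open>At \<open>i = 0\<close> the exponent counts all ones on the diagonal of
      \<open>M\<close>.\<close>
    by (rule basic_degreeI[OF assms(1) mi])
      (use constructor_term_component_bound[OF fin assms(2,3), of 0] in
        \<open>simp add: assms(4) diagonal_ones_def\<close>)
  moreover have "basic_degree k F ar R A 1" if "M = 1\<^sub>m k"
    by (rule basic_degreeI[OF assms(1) mi unit_constructor_term_bound[OF fin mi]])
      (use that assms(3) in simp)
  ultimately show ?thesis by blast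
qed

end
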